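(* Let $f(X)\in\mathbb{Z}[X]$ be a polynomial of degree $n\ge 2$ all of whose coefficients are non-negative integers. If $f(m)$ is a prime number for some integer $m>\frac{1}{\sin\frac{\pi}{n}}$, then $f$ is irreducible over $\mathbb{Q}$. *)

theory Defs
  imports Complex_Main "HOL-Computational_Algebra.Computational_Algebra"
begin

end

theory Submission
  imports Defs
begin

text \<open>A polynomial of degree \<open>n\<close> with non-negative coefficients has no nonzero root in the sector
  \<open>\<bar>Arg z\<bar> < \<pi> / n\<close>: on the open upper half of the sector all the terms
  \<open>a\<^sub>k z\<^sup>k\<close> have non-negative imaginary part and the leading one has positive imaginary part.
  Hence every root has distance at least \<open>m sin (\<pi> / n) > 1\<close> from the point \<open>m\<close>, and every
  non-constant integer polynomial \<open>g\<close> dividing \<open>f\<close> satisfies \<open>\<bar>g(m)\<bar> > 1\<close>. So a factorisation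
  over the rationals, moved to the integers by Gauss's lemma, would split the prime \<open>f(m)\<close>.\<close>

lemma map_poly_of_int_mult:
  "map_poly of_int (p * q) = (map_poly of_int p * map_poly of_int q :: 'a :: comm_ring_1 poly)"
  by (rule poly_eqI) (simp add: coeff_map_poly coeff_mult)

lemma degree_map_poly_of_int [simp]:
  "degree (map_poly of_int p :: 'a :: {comm_ring_1, ring_char_0} poly) = degree p"
  by (rule degree_map_poly) simp

lemma map_poly_of_int_eq_iff:
  "(map_poly of_int p :: 'a :: {comm_ring_1, ring_char_0} poly) = map_poly of_int q \<longleftrightarrow> p = q"
  by (simp add: poly_eq_iff coeff_map_poly)

lemma poly_map_poly_of_int:
  "poly (map_poly of_int p) (of_int x :: 'a :: comm_ring_1) = of_int (poly p x)"
  by (induction p) (auto simp: map_poly_pCons)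

lemma rat_poly_clear_denominators:
  fixes p :: "rat poly"
  obtains c :: int and q :: "int poly"
  where "c > 0" "smult (of_int c) p = map_poly of_int q"
proof -
  have "\<exists>c q. c > 0 \<and> smult (of_int c) p = map_poly of_int q"
  proof (induction p)
    case 0
    show ?case by (intro exI[of _ 1] exI[of _ 0]) simp
  next
    case (pCons a p)
    then obtain c q where q: "c > 0" "smult (of_int c) p = map_poly of_int q"
      by blast
    obtain x y where a: "quotient_of a = (x, y)" by fastforce
    have y: "y > 0" and ay: "of_int y * a = of_int x"
      using quotient_of_denom_pos[OF a] quotient_of_div[OF a] by auto
    \<comment> \<open>The tail is cleared by \<open>c\<close> and the new coefficient
      \<open>a\<close> by its denominator \<open>y\<close>, so the product clears both.\<close>
    have "smult (of_int (y * c)) (pCons a p) =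
        pCons (of_int c * (of_int y * a)) (smult (of_int y) (smult (of_int c) p))"
      by (simp add: mult_ac)
    also have "\<dots> = map_poly of_int (pCons (c * x) (smult y q))"
      unfolding q ay by (intro poly_eqI) (simp add: coeff_map_poly coeff_pCons split: nat.split)
    finally show ?case using q(1) y
      by (intro exI[of _ "y * c"] exI[of _ "pCons (c * x) (smult y q)"]) simp
  qed
  then show ?thesis using that by blast
qed

text \<open>Gauss's lemma: clearing denominators gives \<open>c * d * f = A * B\<close> over the
  integers. Since content is multiplicative, \<open>c * d\<close> times the content of
  \<open>f\<close> is the product of the contents of \<open>A\<close> and \<open>B\<close>; hence
  \<open>c * d\<close> cancels, leaving the primitive parts and the content of \<open>f\<close>,
  which is put into the first factor.\<close>

lemma int_poly_factorization_of_rat: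
  fixes f :: "int poly" and a b :: "rat poly"
  assumes "map_poly of_int f = a * b" and "f \<noteq> 0"
  obtains g h :: "int poly"
  where "f = g * h" "degree g = degree a" "degree h = degree b"
proof -
  obtain c A where A: "c > 0" "smult (of_int c) a = map_poly of_int A"
    by (rule rat_poly_clear_denominators)
  obtain d B where B: "d > 0" "smult (of_int d) b = map_poly of_int B"
    by (rule rat_poly_clear_denominators)
  have degA: "degree A = degree a" and degB: "degree B = degree b"
    using A B by (metis degree_map_poly_of_int degree_smult_eq of_int_eq_0_iff less_irrefl)+
  have "map_poly rat_of_int (smult (c * d) f) = smult (of_int (c * d)) (map_poly of_int f)"
    by (rule poly_eqI) (simp add: coeff_map_poly)
  also have "\<dots> = smult (of_int c) a * smult (of_int d) b"
    by (simp add: assms(1) mult_ac)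
  also have "\<dots> = map_poly of_int (A * B)"
    by (simp add: A B map_poly_of_int_mult)
  finally have cd: "smult (c * d) f = A * B"
    by (simp add: map_poly_of_int_eq_iff)
  have cont: "c * d * content f = content A * content B"
    using arg_cong[OF cd, of content] A(1) B(1) by (simp add: content_mult abs_mult)
  have "smult (c * d) f =
      smult (content A) (primitive_part A) * smult (content B) (primitive_part B)"
    by (simp only: cd content_times_primitive_part)
  also have "\<dots> = smult (content A * content B) (primitive_part A * primitive_part B)"
    by (simp only: mult_smult_left mult_smult_right smult_smult mult.commute)
  also have "\<dots> = smult (c * d) (smult (content f) (primitive_part A) * primitive_part B)"
    by (simp only: cont[symmetric] mult_smult_left smult_smult)
  finally have "f = smult (content f) (primitive_part A) * primitive_part B"
    using A(1) B(1) by (simp add: poly_eq_iff del: mult_smult_left)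
  then show ?thesis
    by (rule that) (use degA degB assms(2) in simp_all)
qed

lemma pos_coeffs_root_Arg_ge:
  fixes f :: "int poly" and z :: complex
  assumes nonneg: "\<And>i. coeff f i \<ge> 0" and n: "degree f > 0"
    and "z \<noteq> 0" and root: "poly (map_poly of_int f) z = 0"
  shows "\<bar>Arg z\<bar> \<ge> pi / degree f"
proof (rule ccontr)
  let ?n = "degree f"
  define r where "r = cmod z"
  define t where "t = Arg z"
  assume "\<not> \<bar>Arg z\<bar> \<ge> pi / ?n"
  then have t: "?n * \<bar>t\<bar> < pi"
    using n by (simp add: field_simps t_def)
  have r: "r > 0" using \<open>z \<noteq> 0\<close> by (simp add: r_def)
  have z: "z = rcis r t" by (simp add: r_def t_def rcis_cmod_Arg)
  have lc: "coeff f ?n > 0"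
    using nonneg[of ?n] n by (metis degree_0 leading_coeff_0_iff less_le order_less_irrefl)
  have sum: "(\<Sum>k\<le>?n. of_int (coeff f k) * rcis (r ^ k) (k * t)) = 0"
    using root by (simp add: poly_altdef coeff_map_poly z DeMoivre2)
  show False
  \<comment> \<open>On the positive real axis all imaginary parts vanish, so there the real parts
    give the contradiction.\<close>
  proof (cases "t = 0")
    case True
    have "(\<Sum>k\<le>?n. of_int (coeff f k) * r ^ k) = 0"
      using arg_cong[OF sum, of Re] True by simp
    moreover have "(\<Sum>k\<le>?n. of_int (coeff f k) * r ^ k) > 0"
      using lc r nonneg by (intro sum_pos2[of _ ?n]) auto
    ultimately show False by simp
  next
    case False
    have "(\<Sum>k\<le>?n. of_int (coeff f k) * (r ^ k * sin (k * t))) = 0"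
      using arg_cong[OF sum, of Im] by simp
    \<comment> \<open>Multiplying the whole sum by \<open>sgn t\<close> reflects the lower half of
      the sector to the upper half, as sine is odd.\<close>
    moreover have "sin (real k * \<bar>t\<bar>) = sgn t * sin (k * t)" for k
      using False by (auto simp: abs_if sgn_if)
    ultimately have "(\<Sum>k\<le>?n. of_int (coeff f k) * (r ^ k * sin (k * \<bar>t\<bar>))) = 0"
      by (simp add: sum_distrib_left[symmetric] mult.left_commute[of _ "sgn t"])
    moreover have "(\<Sum>k\<le>?n. of_int (coeff f k) * (r ^ k * sin (k * \<bar>t\<bar>))) > 0"
    proof (intro sum_pos2[of _ ?n])
      show "0 < of_int (coeff f ?n) * (r ^ ?n * sin (?n * \<bar>t\<bar>))"
        using lc r t n False by (intro mult_pos_pos sin_gt_zero) auto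
      fix k assume "k \<in> {..?n}"
      then have "k * \<bar>t\<bar> \<le> ?n * \<bar>t\<bar>"
        by (intro mult_right_mono) auto
      then show "0 \<le> of_int (coeff f k) * (r ^ k * sin (k * \<bar>t\<bar>))"
        using r t nonneg by (intro mult_nonneg_nonneg sin_ge_zero) auto
    qed auto
    ultimately show False by simp
  qed
qed

text \<open>By the law of cosines the squared distance is
  \<open>x^2 - 2 * x * r * cos t + r^2\<close>, which for fixed modulus \<open>r\<close> can only
  shrink when the angle is reduced to \<open>a\<close>. At angle \<open>a\<close> it is at least the
  squared distance \<open>(x * sin a)^2\<close> from \<open>x\<close> to the line through the origin
  in that direction.\<close>

lemma dist_of_real_ge_sin:
  assumes "0 \<le> x" "0 \<le> a" "a \<le> \<bar>Arg z\<bar>"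
  shows "x * sin a \<le> cmod (of_real x - z)"
proof (rule power2_le_imp_le)
  define r where "r = cmod z"
  define t where "t = Arg z"
  have z: "z = rcis r t" by (simp add: r_def t_def rcis_cmod_Arg)
  have "cos \<bar>t\<bar> \<le> cos a"
    using assms Arg_bounded[of z] by (intro cos_monotone_0_pi_le) (auto simp: t_def)
  then have cos: "cos t \<le> cos a" by simp
  have "(x * sin a)\<^sup>2 \<le> (x * sin a)\<^sup>2 + (r - x * cos a)\<^sup>2"
    by simp
  also have "\<dots> = x\<^sup>2 * ((sin a)\<^sup>2 + (cos a)\<^sup>2) - 2 * x * r * cos a + r\<^sup>2"
    by algebra
  also have "\<dots> \<le> x\<^sup>2 * ((sin t)\<^sup>2 + (cos t)\<^sup>2) - 2 * x * r * cos t + r\<^sup>2 * ((sin t)\<^sup>2 + (cos t)\<^sup>2)"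
    using mult_left_mono[OF cos, of "2 * x * r"] assms(1) by (simp add: r_def)
  also have "\<dots> = (x - r * cos t)\<^sup>2 + (r * sin t)\<^sup>2"
    unfolding sin_cos_squared_add by (simp add: power2_diff power_mult_distrib sin_squared_eq algebra_simps)
  also have "\<dots> = (cmod (of_real x - z))\<^sup>2"
    by (simp add: z cmod_power2)
  finally show "(x * sin a)\<^sup>2 \<le> (cmod (of_real x - z))\<^sup>2" .
qed simp

lemma norm_prod_mset_gt_1:
  fixes g :: "'a \<Rightarrow> 'b :: real_normed_field"
  assumes "A \<noteq> {#}" "\<And>x. x \<in># A \<Longrightarrow> norm (g x) > 1"
  shows "norm (\<Prod>x\<in>#A. g x) > 1"
  using assms
proof (induction A)
  case (add x A)
  then show ?case
    by (cases "A = {#}") (auto simp: norm_mult intro: less_1_mult)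
qed simp

text \<open>Over the complex numbers \<open>g(m)\<close> is the leading coefficient, a nonzero
  integer, times a nonempty product of differences \<open>m - z\<close>, each of modulus above
  1.\<close>

lemma abs_poly_gt_1_if_roots_far:
  fixes g :: "int poly" and m :: int
  assumes "degree g > 0"
    and far: "\<And>z :: complex. poly (map_poly of_int g) z = 0 \<Longrightarrow> cmod (of_int m - z) > 1"
  shows "\<bar>poly g m\<bar> > 1"
proof -
  define G :: "complex poly" where "G = map_poly of_int g"
  have "degree G > 0" using assms by (simp add: G_def)
  then have "G \<noteq> 0" by auto
  then obtain A where A: "size A = degree G" "G = smult (lead_coeff G) (\<Prod>x\<in>#A. [:-x, 1:])"
    using alg_closed_imp_factorization by blast
  have eval: "poly G z = lead_coeff G * (\<Prod>x\<in>#A. z - x)" for z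
    by (subst A(2)) (simp add: poly_prod_mset)
  have "cmod (\<Prod>x\<in>#A. of_int m - x) > 1"
  proof (rule norm_prod_mset_gt_1)
    show "A \<noteq> {#}" using A(1) \<open>degree G > 0\<close> by auto
    fix x assume "x \<in># A"
    then have "poly G x = 0" by (force simp: eval)
    then show "cmod (of_int m - x) > 1" using far by (simp add: G_def)
  qed
  moreover have "cmod (lead_coeff G) \<ge> 1"
  proof -
    have "\<bar>lead_coeff g\<bar> \<ge> 1"
      using assms(1) by (metis abs_ge_zero degree_0 int_one_le_iff_zero_less leading_coeff_0_iff
          less_irrefl zero_less_abs_iff)
    then have "\<bar>real_of_int (lead_coeff g)\<bar> \<ge> 1" by linarith
    then show ?thesis by (simp add: G_def coeff_map_poly)
  qed
  ultimately have "1 < cmod (poly G (of_int m))"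
    unfolding eval norm_mult
    by (metis less_le_trans mult.commute mult_1 mult_left_mono norm_ge_zero)
  also have "\<dots> = \<bar>real_of_int (poly g m)\<bar>"
    by (simp add: G_def poly_map_poly_of_int)
  finally show ?thesis by linarith
qed

theorem corollary3p2:
  fixes f :: "int poly" and n :: nat and m :: int
  assumes "degree f = n" and "n \<ge> 2"
    and "\<And>i. coeff f i \<ge> 0"
    and "real_of_int m > 1 / sin (pi / real n)"
    and "prime (poly f m)"
  shows "irreducible (map_poly rat_of_int f)"
proof (rule irreducibleI)
  let ?F = "map_poly rat_of_int f"
  have deg: "degree ?F = n" using assms(1) by simp
  then show F0: "?F \<noteq> 0" using assms(2) by (metis degree_0 not_numeral_le_zero)
  show "\<not> ?F dvd 1"
    using deg assms(2) F0 by (simp add: is_unit_iff_degree)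
  have "sin (pi / n) > 0"
    using assms(2) by (intro sin_gt_zero) (auto simp: field_simps)
  then have m: "m * sin (pi / n) > 1"
    using assms(4) by (simp add: field_simps)
  have m0: "m > 0"
    using assms(4) \<open>sin (pi / n) > 0\<close> by (smt (verit) divide_pos_pos of_int_pos of_int_0_less_iff)
  have far: "cmod (of_int m - z) > 1" if "poly (map_poly of_int f) z = 0" for z :: complex
  proof (cases "z = 0")
    \<comment> \<open>The root 0 escapes the argument bound, but its distance to \<open>m\<close> is
      \<open>m\<close> itself, and sine is at most 1.\<close>
    case True
    have "m * sin (pi / n) \<le> real_of_int m * 1"
      using m0 by (intro mult_left_mono) auto
    then show ?thesis using m True by simp
  next
    case False
    have "m * sin (pi / n) \<le> cmod (of_real (of_int m) - z)"
      using pos_coeffs_root_Arg_ge[OF assms(3) _ False that] assms(1,2) m0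
      by (intro dist_of_real_ge_sin) auto
    then show ?thesis using m by simp
  qed
  fix a b assume ab: "?F = a * b"
  then have "a \<noteq> 0" "b \<noteq> 0" "f \<noteq> 0" using F0 by auto
  from ab \<open>f \<noteq> 0\<close> obtain g h where gh: "f = g * h" "degree g = degree a" "degree h = degree b"
    by (rule int_poly_factorization_of_rat)
  \<comment> \<open>Here \<open>p\<close> is an integer factor of \<open>f\<close> and
    \<open>q\<close> its rational counterpart. Roots of \<open>p\<close> are roots of
    \<open>f\<close>, so a value of modulus 1 at \<open>m\<close> forces degree 0, and nonzero
    rational constants are units.\<close>
  have dvd1: "q dvd 1" if "\<bar>poly p m\<bar> = 1" "degree p = degree q" "p dvd f" "q \<noteq> 0"
    for p :: "int poly" and q :: "rat poly"
  proof -
    have "degree p = 0"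
    proof (rule ccontr)
      assume "degree p \<noteq> 0"
      then have "\<bar>poly p m\<bar> > 1"
        using \<open>p dvd f\<close> far
        by (intro abs_poly_gt_1_if_roots_far) (auto simp: map_poly_of_int_mult)
      with that show False by simp
    qed
    then show ?thesis using that by (simp add: is_unit_iff_degree)
  qed
  have "irreducible (poly f m)"
    using assms(5) by (intro prime_elem_imp_irreducible prime_imp_prime_elem)
  then have "poly g m dvd 1 \<or> poly h m dvd 1"
    using gh(1) by (auto dest: irreducibleD)
  then show "a dvd 1 \<or> b dvd 1"
    using dvd1[of g a] dvd1[of h b] gh \<open>a \<noteq> 0\<close> \<open>b \<noteq> 0\<close> by auto
qed

end
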